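(* Let $p\in\mathbb{N}$ be a positive integer and let $\alpha$ be a real number. The function $$\theta_{p,\alpha}(x)=x^\alpha\left[\ln\frac{px}{x+p+1}-\psi_p(x)\right]$$ is completely monotonic on $(0,\infty)$ if and only if $\alpha\le 1$.
   Context: $\mathbb{N}$ denotes the set of all positive integers. For $p\in\mathbb{N}$ and $x>0$, the $p$-gamma function is $$\Gamma_p(x)=\frac{p!\,p^x}{x(x+1)\cdots(x+p)},$$ and the $p$-analogue of the psi function is its logarithmic derivative $$\psi_p(x)=\frac{d}{dx}\ln\Gamma_p(x)=\frac{\Gamma_p'(x)}{\Gamma_p(x)},$$ so that $\psi_p(x)=\ln p-\sum_{k=0}^{p}\frac{1}{x+k}$ for $x>0$. A function $f$ is said to be completely monotonic on an interval $I$ if $f$ has derivatives of all orders on $I$ and satisfies $0\le(-1)^{n}f^{(n)}(x)<\infty$ for all $x\in I$ and all integers $n\ge 0$. *)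

theory Defs
  imports "HOL-Analysis.Analysis"
begin

definition p_gamma :: "nat \<Rightarrow> real \<Rightarrow> real" where
  "p_gamma p x = fact p * real p powr x / (\<Prod>k=0..p. x + real k)"

definition p_psi :: "nat \<Rightarrow> real \<Rightarrow> real" where
  "p_psi p x = deriv (\<lambda>y. ln (p_gamma p y)) x"

definition theta :: "nat \<Rightarrow> real \<Rightarrow> real \<Rightarrow> real" where
  "theta p \<alpha> x = x powr \<alpha> * (ln (real p * x / (x + real p + 1)) - p_psi p x)"

(* D n is the n-th derivative of f on I: it is unique on I because I is a nondegenerate
   interval. Derivatives are taken within I, hence one-sided at endpoints belonging to I
   and two-sided everywhere if I is open. *)
definition completely_monotonic_on :: "real set \<Rightarrow> (real \<Rightarrow> real) \<Rightarrow> bool" where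
  "completely_monotonic_on I f \<longleftrightarrow>
     is_interval I \<and> interior I \<noteq> {} \<and>
     (\<exists>D :: nat \<Rightarrow> real \<Rightarrow> real.
        (\<forall>x\<in>I. D 0 x = f x) \<and>
        (\<forall>n. \<forall>x\<in>I. (D n has_real_derivative D (Suc n) x) (at x within I)) \<and>
        (\<forall>n. \<forall>x\<in>I. 0 \<le> (-1) ^ n * D n x))"

end

theory Submission
  imports Defs "HOL-Real_Asymp.Real_Asymp"
begin

text \<open>
  Put \<open>q = p + 1\<close> and \<open>g x = ln (p x / (x + q)) - \<psi>\<^sub>p x\<close>, so that \<open>\<theta> x = x powr (\<alpha> - 1) * (x * g x)\<close>.
  Everything rests on the case \<open>\<alpha> = 1\<close>: the function \<open>F x = x * g x\<close> is completely monotonic.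
  For \<open>\<alpha> \<le> 1\<close> the factor \<open>x powr (\<alpha> - 1)\<close> is completely monotonic as well, and a product of
  completely monotonic functions is one by the Leibniz rule.  For \<open>\<alpha> > 1\<close>, on the other hand,
  \<open>F\<close> tends to 1 at 0, so \<open>\<theta>\<close> tends to 0 there; a nonnegative decreasing function with that limit
  vanishes identically, which would make \<open>F\<close> zero.

  A Laplace representation explains why \<open>F\<close> is completely monotonic:
  \<open>F\<close> is the transform of the derivative of
  \<open>(1 - exp (- q s)) * (1 / (1 - exp (- s)) - 1 / s)\<close>, a product of two increasing positive
  functions of \<open>s\<close>.  The proof given here replaces the transform by finite differences.  Multiplying
  the density by \<open>(1 - exp (- s))\<^sup>2\<close>, that is, taking the second difference
  \<open>F x - 2 * F (x + 1) + F (x + 2)\<close>, leaves an elementary function (\<open>theta1_deriv_second_difference\<close>):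
  with \<open>u x = x ln x - x\<close> it equals \<open>K x - K (x + q) + q * (H (x + q) - H (x + q + 1))\<close>, where
  \<^item> \<open>K x = u x - 2 * u (x + 1) + u (x + 2) - u'' (x + 1)\<close> compares a second difference with a second
    derivative,
  \<^item> \<open>H x = 1 / x - (ln (x + 1) - ln x)\<close> compares a first difference with a first derivative.

  Both are completely monotonic, by Taylor's theorem and the mean value theorem applied to every
  derivative, because \<open>u'' x = 1 / x\<close> is.  Hence all signed derivatives of \<open>F\<close> have nonnegative
  second differences; they tend to 0 at infinity, and a convex sequence that tends to 0 is
  nonnegative (\<open>cm_seq_if_second_difference\<close>).
\<close>

section \<open>Sequences of successive derivatives\<close>

text \<open>
  Complete monotonicity asserts the existence of a sequence of derivatives.  Reasoning about such
  sequences themselves, on the half-line \<open>x > 0\<close>, keeps higher derivatives explicit.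
\<close>

definition deriv_seq :: "(nat \<Rightarrow> real \<Rightarrow> real) \<Rightarrow> bool" where
  "deriv_seq D \<longleftrightarrow> (\<forall>n. \<forall>x>0. (D n has_real_derivative D (Suc n) x) (at x))"

definition cm_seq :: "(nat \<Rightarrow> real \<Rightarrow> real) \<Rightarrow> bool" where
  "cm_seq D \<longleftrightarrow> deriv_seq D \<and> (\<forall>n. \<forall>x>0. 0 \<le> (-1) ^ n * D n x)"

lemma deriv_seqD:
  "deriv_seq D \<Longrightarrow> 0 < x \<Longrightarrow> (D n has_real_derivative D (Suc n) x) (at x)"
  by (simp add: deriv_seq_def)

lemma cm_seqD:
  assumes "cm_seq D"
  shows "deriv_seq D" and "\<And>n x. 0 < x \<Longrightarrow> 0 \<le> (-1) ^ n * D n x"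
  using assms by (simp_all add: cm_seq_def)

lemma completely_monotonic_on_pos_iff:
  "completely_monotonic_on {0<..} f \<longleftrightarrow> (\<exists>D. cm_seq D \<and> (\<forall>x>0. D 0 x = f x))"
proof -
  have "at x within {0<..} = at x" if "0 < x" for x :: real
    using that by (intro at_within_open) auto
  moreover have "interior {0::real<..} \<noteq> {}"
    by (simp add: interior_open)
  ultimately show ?thesis
    unfolding completely_monotonic_on_def cm_seq_def deriv_seq_def
    by (simp add: Ball_def conj_commute conj_left_commute)
qed

lemma deriv_seq_shift:
  assumes "deriv_seq D" "0 < x" "0 \<le> c"
  shows "((\<lambda>x. D n (x + c)) has_real_derivative D (Suc n) (x + c)) (at x)"
proof -
  have "(D n has_real_derivative D (Suc n) (x + c)) (at (x + c))"
    using assms by (intro deriv_seqD) auto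
  then show ?thesis
    by (simp add: DERIV_shift)
qed

lemma cm_seq_decreasing:
  assumes "cm_seq D" "0 < x" "x \<le> y"
  shows "(-1) ^ n * D n y \<le> (-1) ^ n * D n x"
proof (rule DERIV_nonpos_imp_nonincreasing[OF \<open>x \<le> y\<close>])
  fix z assume "x \<le> z" "z \<le> y"
  then have z: "0 < z" using assms by simp
  have "((\<lambda>x. (-1) ^ n * D n x) has_real_derivative (-1) ^ n * D (Suc n) z) (at z)"
    using cm_seqD(1)[OF assms(1)] z by (intro DERIV_cmult deriv_seqD)
  moreover have "(-1) ^ n * D (Suc n) z \<le> 0"
    using cm_seqD(2)[OF assms(1) z, of "Suc n"] by simp
  ultimately show "\<exists>d. ((\<lambda>x. (-1) ^ n * D n x) has_real_derivative d) (at z) \<and> d \<le> 0"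
    by blast
qed

text \<open>
  The differences \<open>a m - a (m + 1)\<close> decrease to 0, hence are nonnegative; so \<open>a\<close> itself
  decreases to 0.
\<close>

lemma convex_null_sequence_nonneg:
  fixes a :: "nat \<Rightarrow> real"
  assumes convex: "\<And>m. 0 \<le> a m - 2 * a (Suc m) + a (Suc (Suc m))"
    and null: "a \<longlonglongrightarrow> 0"
  shows "0 \<le> a m"
proof -
  have "decseq (\<lambda>m. a m - a (Suc m))"
    using convex by (intro decseq_SucI) (simp add: algebra_simps)
  moreover have "(\<lambda>m. a m - a (Suc m)) \<longlonglongrightarrow> 0"
    using tendsto_diff[OF null LIMSEQ_Suc[OF null]] by simp
  ultimately have "0 \<le> a m - a (Suc m)" for m
    by (rule decseq_ge)
  then have "decseq a"
    by (intro decseq_SucI) (simp add: algebra_simps)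
  then show ?thesis
    using null by (rule decseq_ge)
qed

text \<open>
  A sign criterion that asks only for the second differences of a function: they may be far
  simpler than the function, as the two subtractions can telescope a long sum.
\<close>

lemma cm_seq_if_second_difference:
  assumes "deriv_seq D"
    and second: "\<And>n x. 0 < x \<Longrightarrow> 0 \<le> (-1) ^ n * (D n x - 2 * D n (x + 1) + D n (x + 2))"
    and null: "\<And>n. (D n \<longlongrightarrow> 0) at_top"
  shows "cm_seq D"
  unfolding cm_seq_def
proof (intro conjI allI impI)
  fix n and x :: real assume "0 < x"
  define a where "a m = (-1) ^ n * D n (x + real m)" for m
  have "filterlim (\<lambda>m. x + real m) at_top sequentially"
    by real_asymp
  then have "a \<longlonglongrightarrow> (-1) ^ n * 0"
    unfolding a_def by (intro tendsto_mult tendsto_const filterlim_compose[OF null])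
  moreover have "0 \<le> a m - 2 * a (Suc m) + a (Suc (Suc m))" for m
  proof -
    have "a m - 2 * a (Suc m) + a (Suc (Suc m)) =
        (-1) ^ n * (D n (x + real m) - 2 * D n (x + real m + 1) + D n (x + real m + 2))"
      by (simp add: a_def right_diff_distrib distrib_left add_ac)
    also have "0 \<le> \<dots>"
      using \<open>0 < x\<close> by (intro second) simp
    finally show ?thesis .
  qed
  ultimately have "0 \<le> a 0"
    using convex_null_sequence_nonneg[of a 0] by simp
  then show "0 \<le> (-1) ^ n * D n x"
    by (simp add: a_def)
qed fact

text \<open>
  The induction step of the Leibniz rule, which is Pascal's identity for the coefficients.
\<close>

lemma deriv_seq_Leibniz:
  assumes "deriv_seq A" "deriv_seq B"
  shows "deriv_seq (\<lambda>n x. \<Sum>i\<le>n. real (n choose i) * A i x * B (n - i) x)"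
  unfolding deriv_seq_def
proof (intro allI impI)
  fix n and x :: real assume x: "0 < x"
  have "((\<lambda>x. \<Sum>i\<le>n. real (n choose i) * A i x * B (n - i) x) has_real_derivative
      (\<Sum>i\<le>n. real (n choose i) * (A (Suc i) x * B (n - i) x + A i x * B (Suc (n - i)) x))) (at x)"
    using deriv_seqD[OF assms(1) x] deriv_seqD[OF assms(2) x]
    by (auto intro!: derivative_eq_intros simp: algebra_simps)
  also have "(\<Sum>i\<le>n. real (n choose i) * (A (Suc i) x * B (n - i) x + A i x * B (Suc (n - i)) x)) =
      (\<Sum>i\<le>n. real (n choose i) * (A (Suc i) x * B (n - i) x)) +
      (\<Sum>i\<le>n. real (n choose i) * (A i x * B (Suc n - i) x))"
    by (simp add: distrib_left sum.distrib Suc_diff_le)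
  \<comment> \<open>The extra term \<open>i = Suc n\<close> has coefficient 0; it allows the index shift that follows.\<close>
  also have "(\<Sum>i\<le>n. real (n choose i) * (A i x * B (Suc n - i) x)) =
      (\<Sum>i\<le>Suc n. real (n choose i) * (A i x * B (Suc n - i) x))"
    by simp
  also have "\<dots> = A 0 x * B (Suc n) x +
      (\<Sum>i\<le>n. real (n choose Suc i) * (A (Suc i) x * B (n - i) x))"
    by (subst sum.atMost_Suc_shift) simp
  also have "(\<Sum>i\<le>n. real (n choose i) * (A (Suc i) x * B (n - i) x)) + \<dots> =
      (\<Sum>i\<le>Suc n. real (Suc n choose i) * A i x * B (Suc n - i) x)"
    by (subst sum.atMost_Suc_shift) (simp add: sum.distrib algebra_simps)
  finally show "((\<lambda>x. \<Sum>i\<le>n. real (n choose i) * A i x * B (n - i) x) has_real_derivative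
      (\<Sum>i\<le>Suc n. real (Suc n choose i) * A i x * B (Suc n - i) x)) (at x)" .
qed

lemma cm_seq_Leibniz:
  assumes "cm_seq A" "cm_seq B"
  shows "cm_seq (\<lambda>n x. \<Sum>i\<le>n. real (n choose i) * A i x * B (n - i) x)"
  unfolding cm_seq_def
proof (intro conjI allI impI)
  fix n and x :: real assume x: "0 < x"
  have "0 \<le> (-1) ^ n * (real (n choose i) * A i x * B (n - i) x)" if "i \<le> n" for i
  proof -
    have "(-1::real) ^ n = (-1) ^ i * (-1) ^ (n - i)"
      using that by (simp add: power_add[symmetric])
    then have "(-1) ^ n * (real (n choose i) * A i x * B (n - i) x) =
        real (n choose i) * ((-1) ^ i * A i x) * ((-1) ^ (n - i) * B (n - i) x)"
      by simp
    also have "0 \<le> \<dots>"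
      by (intro mult_nonneg_nonneg of_nat_0_le_iff cm_seqD(2)[OF assms(1) x] cm_seqD(2)[OF assms(2) x])
    finally show ?thesis .
  qed
  then show "0 \<le> (-1) ^ n * (\<Sum>i\<le>n. real (n choose i) * A i x * B (n - i) x)"
    unfolding sum_distrib_left by (intro sum_nonneg) simp
qed (intro deriv_seq_Leibniz cm_seqD assms)

lemma cm_seq_powr:
  assumes "0 \<le> \<beta>"
  shows "cm_seq (\<lambda>n x. (\<Prod>i<n. - \<beta> - real i) * x powr (- \<beta> - real n))"
  unfolding cm_seq_def deriv_seq_def
proof (intro conjI allI impI)
  fix n and x :: real assume x: "0 < x"
  have "((\<lambda>x. (\<Prod>i<n. - \<beta> - real i) * x powr (- \<beta> - real n)) has_real_derivative
      (\<Prod>i<n. - \<beta> - real i) * ((- \<beta> - real n) * x powr (- \<beta> - real n - 1))) (at x)"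
    using x by (intro DERIV_cmult has_real_derivative_powr)
  then show "((\<lambda>x. (\<Prod>i<n. - \<beta> - real i) * x powr (- \<beta> - real n)) has_real_derivative
      (\<Prod>i<Suc n. - \<beta> - real i) * x powr (- \<beta> - real (Suc n))) (at x)"
    by (simp add: algebra_simps)
  have "(-1) ^ n * (\<Prod>i<n. - \<beta> - real i) = (\<Prod>i<n. \<beta> + real i)"
    by (induction n) (simp_all add: algebra_simps)
  moreover have "0 \<le> (\<Prod>i<n. \<beta> + real i)"
    using assms by (intro prod_nonneg) auto
  ultimately show "0 \<le> (-1) ^ n * ((\<Prod>i<n. - \<beta> - real i) * x powr (- \<beta> - real n))"
    by (simp flip: mult.assoc)
qed

section \<open>Derivatives of \<open>x ln x - x\<close>\<close>

text \<open>
  The summand \<open>- x\<close> makes the first derivative exactly \<open>ln x\<close>, so that the logarithm and the powers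
  of \<open>1 / x\<close> all occur in one sequence.  It also absorbs the constant term of \<open>theta1_deriv\<close> below.
\<close>

fun xlnx_deriv :: "nat \<Rightarrow> real \<Rightarrow> real" where
  "xlnx_deriv 0 x = x * ln x - x"
| "xlnx_deriv (Suc 0) x = ln x"
| "xlnx_deriv (Suc (Suc n)) x = (-1) ^ n * fact n / x ^ Suc n"

lemma deriv_seq_xlnx: "deriv_seq xlnx_deriv"
  unfolding deriv_seq_def
proof (intro allI impI)
  fix n and x :: real assume x: "0 < x"
  consider "n = 0" | "n = Suc 0" | m where "n = Suc (Suc m)"
    by (metis not0_implies_Suc)
  then show "(xlnx_deriv n has_real_derivative xlnx_deriv (Suc n) x) (at x)"
  proof cases
    case 1
    have "((\<lambda>x. x * ln x - x) has_real_derivative ln x) (at x)"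
      using x by (auto intro!: derivative_eq_intros)
    moreover have "xlnx_deriv 0 = (\<lambda>x. x * ln x - x)"
      by (simp add: fun_eq_iff)
    ultimately show ?thesis using 1 by simp
  next
    case 2
    moreover have "xlnx_deriv (Suc 0) = ln"
      by (simp add: fun_eq_iff)
    ultimately show ?thesis using x by (auto intro!: derivative_eq_intros)
  next
    case (3 m)
    have "((\<lambda>x. x ^ Suc m) has_real_derivative real (Suc m) * x ^ m) (at x)"
      using DERIV_pow[of "Suc m" x] by simp
    from DERIV_divide[OF DERIV_const[of "(-1) ^ m * fact m"] this]
    have "((\<lambda>x. (-1) ^ m * fact m / x ^ Suc m) has_real_derivative
        (0 * x ^ Suc m - (-1) ^ m * fact m * (real (Suc m) * x ^ m)) / (x ^ Suc m * x ^ Suc m)) (at x)"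
      using x by simp
    also have "(0 * x ^ Suc m - (-1) ^ m * fact m * (real (Suc m) * x ^ m)) / (x ^ Suc m * x ^ Suc m) =
        (-1) ^ Suc m * fact (Suc m) / x ^ Suc (Suc m)"
      using x by (simp add: field_simps)
    finally have "((\<lambda>x. (-1) ^ m * fact m / x ^ Suc m) has_real_derivative
        (-1) ^ Suc m * fact (Suc m) / x ^ Suc (Suc m)) (at x)" .
    moreover have "xlnx_deriv n = (\<lambda>x. (-1) ^ m * fact m / x ^ Suc m)"
      by (simp add: fun_eq_iff 3)
    ultimately show ?thesis using 3 by simp
  qed
qed

lemma xlnx_sign: "0 < x \<Longrightarrow> 0 \<le> (-1) ^ n * xlnx_deriv (Suc (Suc n)) x"
  by simp

text \<open>
  From the second derivative on, the sequence consists of the derivatives of \<open>1 / x\<close>.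
\<close>

lemma cm_seq_inverse: "cm_seq (\<lambda>n. xlnx_deriv (Suc (Suc n)))"
  using deriv_seq_xlnx xlnx_sign unfolding cm_seq_def deriv_seq_def by blast

text \<open>
  Expand \<open>v\<close>, the \<open>n\<close>-th derivative with sign \<open>(-1) ^ n\<close>, at \<open>y\<close> up to order 3.  In
  \<open>v (y - 1) + v (y + 1)\<close> the odd terms cancel, and the remainders are nonnegative
  because the fourth derivative of \<open>v\<close> is.
\<close>

lemma xlnx_second_difference_ge:
  assumes "1 < y"
  shows "0 \<le> (-1) ^ n * (xlnx_deriv n (y - 1) - 2 * xlnx_deriv n y + xlnx_deriv n (y + 1) - xlnx_deriv (Suc (Suc n)) y)"
proof -
  define v where "v m x = (-1) ^ n * xlnx_deriv (n + m) x" for m x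
  have deriv: "(v m has_real_derivative v (Suc m) x) (at x)" if "0 < x" for m x
    using DERIV_cmult[OF deriv_seqD[OF deriv_seq_xlnx that], of "(-1) ^ n" "n + m"]
    by (simp add: v_def[abs_def] del: xlnx_deriv.simps)
  have fourth: "0 \<le> v 4 x" if "0 < x" for x
    using xlnx_sign[OF that, of "Suc (Suc n)"] by (simp add: v_def numeral_eq_Suc)
  have taylor: "v 0 y + v 1 y * (x - y) + v 2 y / 2 * (x - y) ^ 2 + v 3 y / 6 * (x - y) ^ 3 \<le> v 0 x"
    if "x \<in> {y - 1, y + 1}" for x
  proof -
    have "\<exists>t. (if x < y then x < t \<and> t < y else y < t \<and> t < x) \<and>
        v 0 x = (\<Sum>m<4. v m y / fact m * (x - y) ^ m) + v 4 t / fact 4 * (x - y) ^ 4"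
      using that assms by (intro Taylor[where a = "y - 1" and b = "y + 1"]) (auto intro!: deriv)
    then obtain t where "(if x < y then x < t \<and> t < y else y < t \<and> t < x)" and
      t: "v 0 x = (\<Sum>m<4. v m y / fact m * (x - y) ^ m) + v 4 t / fact 4 * (x - y) ^ 4"
      by blast
    then have "0 < t"
      using that assms by (auto split: if_splits)
    have "0 \<le> v 4 t / fact 4 * (x - y) ^ 4"
      using fourth[OF \<open>0 < t\<close>] by simp
    then show ?thesis
      unfolding t by (simp add: eval_nat_numeral)
  qed
  have "2 * v 0 y + v 2 y \<le> v 0 (y - 1) + v 0 (y + 1)"
    using taylor[of "y - 1"] taylor[of "y + 1"] by simp
  then show ?thesis
    by (simp add: v_def algebra_simps)
qed

definition curvature_gap :: "nat \<Rightarrow> real \<Rightarrow> real" where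
  "curvature_gap n x =
     xlnx_deriv n x - 2 * xlnx_deriv n (x + 1) + xlnx_deriv n (x + 2) - xlnx_deriv (Suc (Suc n)) (x + 1)"

lemma cm_seq_curvature_gap: "cm_seq curvature_gap"
  unfolding cm_seq_def
proof (intro conjI allI impI)
  show "deriv_seq curvature_gap"
    unfolding deriv_seq_def curvature_gap_def
    by (auto intro!: DERIV_diff DERIV_add DERIV_cmult deriv_seqD[OF deriv_seq_xlnx]
        deriv_seq_shift[OF deriv_seq_xlnx] simp del: xlnx_deriv.simps)
  show "0 \<le> (-1) ^ n * curvature_gap n x" if "0 < x" for n x
    using xlnx_second_difference_ge[of "x + 1" n] that
    by (simp add: curvature_gap_def add.assoc)
qed

definition slope_gap :: "nat \<Rightarrow> real \<Rightarrow> real" where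
  "slope_gap n x = xlnx_deriv (Suc (Suc n)) x - (xlnx_deriv (Suc n) (x + 1) - xlnx_deriv (Suc n) x)"

text \<open>
  By the mean value theorem the difference of logarithms is \<open>1 / z\<close> for some \<open>z > x\<close>, hence less than
  \<open>1 / x\<close>; the derivatives behave in the same way since \<open>1 / x\<close> is completely monotonic.
\<close>

lemma cm_seq_slope_gap: "cm_seq slope_gap"
  unfolding cm_seq_def
proof (intro conjI allI impI)
  show "deriv_seq slope_gap"
    unfolding deriv_seq_def slope_gap_def
    by (auto intro!: DERIV_diff deriv_seqD[OF deriv_seq_xlnx]
        deriv_seq_shift[OF deriv_seq_xlnx] simp del: xlnx_deriv.simps)
  fix n and x :: real assume x: "0 < x"
  have "\<exists>z>x. z < x + 1 \<and>
      xlnx_deriv (Suc n) (x + 1) - xlnx_deriv (Suc n) x = (x + 1 - x) * xlnx_deriv (Suc (Suc n)) z"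
    using x by (intro MVT2 deriv_seqD[OF deriv_seq_xlnx]) auto
  then obtain z where z: "x < z"
    and eq: "xlnx_deriv (Suc n) (x + 1) - xlnx_deriv (Suc n) x = xlnx_deriv (Suc (Suc n)) z"
    by auto
  have "(-1) ^ n * xlnx_deriv (Suc (Suc n)) z \<le> (-1) ^ n * xlnx_deriv (Suc (Suc n)) x"
    using cm_seq_decreasing[OF cm_seq_inverse x, of z n] z by (simp del: xlnx_deriv.simps)
  then show "0 \<le> (-1) ^ n * slope_gap n x"
    unfolding slope_gap_def eq by (simp add: right_diff_distrib del: xlnx_deriv.simps)
qed

section \<open>Complete monotonicity for exponent 1\<close>

text \<open>
  For \<open>q = p + 1\<close> and \<open>n = 0\<close> this is \<open>x * (ln x - ln (x + q) + (\<Sum>k<q. 1 / (x + k)))\<close>, the function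
  \<open>\<theta>\<close> with exponent 1, after \<open>x / (x + k)\<close> is written as \<open>1 - k / (x + k)\<close>.  In this form no factor
  \<open>x\<close> multiplies another function, so a derivative is obtained by raising the indices.
\<close>

definition theta1_deriv :: "nat \<Rightarrow> nat \<Rightarrow> real \<Rightarrow> real" where
  "theta1_deriv q n x = xlnx_deriv n x - xlnx_deriv n (x + real q) + real q * xlnx_deriv (Suc n) (x + real q)
     - (\<Sum>k<q. real k * xlnx_deriv (Suc (Suc n)) (x + real k))"

lemma deriv_seq_theta1_deriv: "deriv_seq (theta1_deriv q)"
  unfolding deriv_seq_def theta1_deriv_def
  by (auto intro!: DERIV_diff DERIV_add DERIV_cmult DERIV_sum deriv_seqD[OF deriv_seq_xlnx]
        deriv_seq_shift[OF deriv_seq_xlnx] simp del: xlnx_deriv.simps)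

text \<open>
  The weights \<open>k\<close> are linear, so the second difference telescopes to boundary terms.
\<close>

lemma weighted_sum_second_difference:
  fixes r :: "real \<Rightarrow> real"
  shows "(\<Sum>k<q. real k * r (x + real k)) - 2 * (\<Sum>k<q. real k * r (x + 1 + real k))
      + (\<Sum>k<q. real k * r (x + 2 + real k)) =
    r (x + 1) - r (x + real q + 1) - real q * (r (x + real q) - r (x + real q + 1))"
  by (induction q) (simp_all add: algebra_simps)

text \<open>
  The boundary terms of the sum are exactly those that complete the second differences of \<open>x ln x - x\<close>
  at \<open>x\<close> and \<open>x + q\<close>, and the one of \<open>ln\<close> at \<open>x + q\<close>, to the completely monotonic gap functions.
\<close>

lemma theta1_deriv_second_difference:
  "theta1_deriv q n x - 2 * theta1_deriv q n (x + 1) + theta1_deriv q n (x + 2) =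
     (curvature_gap n x - curvature_gap n (x + real q)) +
     real q * (slope_gap n (x + real q) - slope_gap n (x + real q + 1))"
  using weighted_sum_second_difference[where r = "xlnx_deriv (Suc (Suc n))" and q = q and x = x]
  by (simp add: theta1_deriv_def curvature_gap_def slope_gap_def algebra_simps del: xlnx_deriv.simps)

text \<open>
  Only for \<open>n \<le> 1\<close> do the leading terms diverge individually, and there they cancel; every other term
  is a multiple of a negative power of \<open>x + c\<close> for some \<open>c \<ge> 0\<close>.
\<close>

lemma theta1_deriv_tendsto_0: "(theta1_deriv q n \<longlongrightarrow> 0) at_top"
proof -
  have vanish: "((\<lambda>x. xlnx_deriv (Suc (Suc m)) (x + c)) \<longlongrightarrow> 0) at_top" for m c
  proof -
    have "filterlim (\<lambda>x. x + c) at_top at_top"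
      by real_asymp
    then show ?thesis
      unfolding xlnx_deriv.simps
      by (intro tendsto_divide_0[OF tendsto_const] filterlim_at_top_imp_at_infinity
          filterlim_pow_at_top) simp_all
  qed
  have "((\<lambda>x. xlnx_deriv n x - xlnx_deriv n (x + real q) + real q * xlnx_deriv (Suc n) (x + real q)) \<longlongrightarrow> 0) at_top"
  proof (cases "q = 0")
    case False
    consider "n = 0" | "n = Suc 0" | m where "n = Suc (Suc m)"
      by (metis not0_implies_Suc)
    then show ?thesis
    proof cases
      case 1
      have "((\<lambda>x. x * ln x - x - ((x + c) * ln (x + c) - (x + c)) + c * ln (x + c)) \<longlongrightarrow> 0) at_top"
        if "0 < c" for c :: real
        using that by real_asymp
      from this[of "real q"] show ?thesis using 1 False by simp
    next
      case 2
      have "((\<lambda>x. ln x - ln (x + c) + c / (x + c)) \<longlongrightarrow> 0) at_top" if "0 < c" for c :: real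
        using that by real_asymp
      from this[of "real q"] show ?thesis using 2 False by simp
    next
      case (3 m)
      show ?thesis
        using tendsto_add[OF tendsto_diff[OF vanish[of m 0] vanish[of m q]]
            tendsto_mult[OF tendsto_const vanish[of "Suc m" q]]]
        by (simp add: 3 del: xlnx_deriv.simps)
    qed
  qed simp
  moreover have "((\<lambda>x. \<Sum>k<q. real k * xlnx_deriv (Suc (Suc n)) (x + real k)) \<longlongrightarrow> (\<Sum>k<q. real k * 0)) at_top"
    by (intro tendsto_sum tendsto_mult tendsto_const vanish)
  ultimately show ?thesis
    unfolding theta1_deriv_def using tendsto_diff by fastforce
qed

lemma cm_seq_theta1_deriv: "cm_seq (theta1_deriv q)"
proof (rule cm_seq_if_second_difference)
  fix n and x :: real assume x: "0 < x"
  have "(-1) ^ n * curvature_gap n (x + real q) \<le> (-1) ^ n * curvature_gap n x"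
    using x by (intro cm_seq_decreasing[OF cm_seq_curvature_gap]) auto
  moreover have "(-1) ^ n * slope_gap n (x + real q + 1) \<le> (-1) ^ n * slope_gap n (x + real q)"
    using x by (intro cm_seq_decreasing[OF cm_seq_slope_gap]) auto
  then have "0 \<le> real q * ((-1) ^ n * slope_gap n (x + real q) - (-1) ^ n * slope_gap n (x + real q + 1))"
    by simp
  ultimately show
    "0 \<le> (-1) ^ n * (theta1_deriv q n x - 2 * theta1_deriv q n (x + 1) + theta1_deriv q n (x + 2))"
    unfolding theta1_deriv_second_difference by (simp add: algebra_simps)
qed (rule deriv_seq_theta1_deriv theta1_deriv_tendsto_0)+

section \<open>The psi function and the exponent\<close>

lemma p_psi_eq:
  assumes "1 \<le> p" "0 < x"
  shows "p_psi p x = ln (real p) - (\<Sum>k\<le>p. 1 / (x + real k))"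
proof -
  let ?f = "\<lambda>y. ln (fact p) + y * ln (real p) - (\<Sum>k\<le>p. ln (y + real k))"
  have "ln (p_gamma p y) = ?f y" if "0 < y" for y
  proof -
    have pos: "0 < (\<Prod>k\<le>p. y + real k)"
      using that by (intro prod_pos) auto
    have "ln (\<Prod>k\<le>p. y + real k) = (\<Sum>k\<le>p. ln (y + real k))"
      using that by (intro ln_prod) auto
    moreover have "ln (p_gamma p y) = ln (fact p * real p powr y) - ln (\<Prod>k\<le>p. y + real k)"
      unfolding p_gamma_def atMost_atLeast0[symmetric] using assms pos
      by (intro ln_divide_pos) auto
    ultimately show ?thesis
      using assms by (simp add: ln_mult)
  qed
  then have "eventually (\<lambda>y. ln (p_gamma p y) = ?f y) (nhds x)"
    using assms by (auto intro!: eventually_nhds_in_open[of "{0<..}", THEN eventually_mono])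
  then have "p_psi p x = deriv ?f x"
    unfolding p_psi_def by (intro deriv_cong_ev) auto
  also have "\<dots> = ln (real p) - (\<Sum>k\<le>p. 1 / (x + real k))"
    using assms by (intro DERIV_imp_deriv) (auto intro!: derivative_eq_intros)
  finally show ?thesis .
qed

lemma theta_eq:
  assumes "1 \<le> p" "0 < x"
  shows "theta p \<alpha> x = x powr (\<alpha> - 1) * theta1_deriv (Suc p) 0 x"
proof -
  let ?q = "real (Suc p)"
  have "x * (\<Sum>k<Suc p. 1 / (x + real k)) = (\<Sum>k<Suc p. 1 - real k * (1 / (x + real k)))"
    unfolding sum_distrib_left using assms by (intro sum.cong) (auto simp: field_simps)
  also have "\<dots> = ?q - (\<Sum>k<Suc p. real k * (1 / (x + real k)))"
    by (subst sum_subtractf) simp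
  finally have sum: "x * (\<Sum>k<Suc p. 1 / (x + real k)) = \<dots>" .
  have "ln (real p * x / (x + real p + 1)) = ln (real p) + ln x - ln (x + ?q)"
    using assms by (simp add: ln_div ln_mult add_ac)
  then have "x * (ln (real p * x / (x + real p + 1)) - p_psi p x) =
      x * (ln (real p) + ln x - ln (x + ?q) - (ln (real p) - (\<Sum>k<Suc p. 1 / (x + real k))))"
    by (simp only: p_psi_eq[OF assms] lessThan_Suc_atMost)
  also have "\<dots> = x * ln x - x * ln (x + ?q) + x * (\<Sum>k<Suc p. 1 / (x + real k))"
    by (simp add: algebra_simps del: sum.lessThan_Suc)
  also have "\<dots> = theta1_deriv (Suc p) 0 x"
    unfolding sum theta1_deriv_def by (simp add: algebra_simps)
  finally have "theta1_deriv (Suc p) 0 x =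
      x * (ln (real p * x / (x + real p + 1)) - p_psi p x)" ..
  moreover have "x powr \<alpha> = x powr (\<alpha> - 1) * x"
    using assms by (simp add: powr_diff)
  ultimately show ?thesis
    by (simp only: theta_def mult.assoc)
qed

text \<open>
  The first three terms contribute \<open>q\<close>, and each of the \<open>q - 1\<close> summands with \<open>k > 0\<close> takes away 1.
\<close>

lemma theta1_deriv_tendsto_1_at_0:
  assumes "0 < q"
  shows "(theta1_deriv q 0 \<longlongrightarrow> 1) (at_right 0)"
proof -
  have "((\<lambda>x. x * ln x - x - ((x + c) * ln (x + c) - (x + c)) + c * ln (x + c)) \<longlongrightarrow> c) (at_right 0)"
    if "0 < c" for c :: real
    using that by real_asymp
  from this[of "real q"]
  have "((\<lambda>x. xlnx_deriv 0 x - xlnx_deriv 0 (x + real q) + real q * xlnx_deriv (Suc 0) (x + real q)) \<longlongrightarrow> real q) (at_right 0)"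
    using assms by simp
  moreover have "((\<lambda>x. \<Sum>k<q. real k * xlnx_deriv (Suc (Suc 0)) (x + real k)) \<longlongrightarrow>
      (\<Sum>k<q. if k = 0 then 0 else 1)) (at_right 0)"
  proof (intro tendsto_sum)
    fix k
    have "((\<lambda>x. c / (x + c)) \<longlongrightarrow> 1) (at_right 0)" if "0 < c" for c :: real
      using that by real_asymp
    from this[of "real k"]
    show "((\<lambda>x. real k * xlnx_deriv (Suc (Suc 0)) (x + real k)) \<longlongrightarrow> (if k = 0 then 0 else 1)) (at_right 0)"
      by (cases "k = 0") simp_all
  qed
  moreover have "(\<Sum>k<q. if k = 0 then 0 else 1) = real q - 1"
    using assms by (cases q) (simp_all add: sum.lessThan_Suc_shift del: sum.lessThan_Suc)
  ultimately show ?thesis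
    unfolding theta1_deriv_def using tendsto_diff by fastforce
qed

theorem theorem1p1:
  fixes p :: nat and \<alpha> :: real
  assumes "p \<ge> 1"
  shows "completely_monotonic_on {0<..} (theta p \<alpha>) \<longleftrightarrow> \<alpha> \<le> 1"
proof
  assume "\<alpha> \<le> 1"
  \<comment> \<open>The derivatives of \<open>x powr (\<alpha> - 1)\<close>, written with the nonnegative number \<open>1 - \<alpha>\<close>.\<close>
  define A where "A n x = (\<Prod>i<n. - (1 - \<alpha>) - real i) * x powr (- (1 - \<alpha>) - real n)" for n x
  have "cm_seq A"
    unfolding A_def using \<open>\<alpha> \<le> 1\<close> by (intro cm_seq_powr) simp
  then have "cm_seq (\<lambda>n x. \<Sum>i\<le>n. real (n choose i) * A i x * theta1_deriv (Suc p) (n - i) x)"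
    using cm_seq_theta1_deriv by (rule cm_seq_Leibniz)
  then show "completely_monotonic_on {0<..} (theta p \<alpha>)"
    unfolding completely_monotonic_on_pos_iff
    by (intro exI conjI allI impI) (assumption, simp add: A_def theta_eq[OF assms])
next
  assume "completely_monotonic_on {0<..} (theta p \<alpha>)"
  then obtain D where D: "cm_seq D" and D0: "\<And>x. 0 < x \<Longrightarrow> D 0 x = theta p \<alpha> x"
    unfolding completely_monotonic_on_pos_iff by blast
  note lim1 = theta1_deriv_tendsto_1_at_0[of "Suc p"]
  show "\<alpha> \<le> 1"
  proof (rule ccontr)
    assume "\<not> \<alpha> \<le> 1"
    then have "((\<lambda>x. x powr (\<alpha> - 1)) \<longlongrightarrow> 0) (at_right 0)"
      by real_asymp
    then have "((\<lambda>x. x powr (\<alpha> - 1) * theta1_deriv (Suc p) 0 x) \<longlongrightarrow> 0) (at_right 0)"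
      using lim1 tendsto_mult by fastforce
    moreover have pos: "eventually (\<lambda>x. 0 < (x::real)) (at_right 0)"
      by (simp add: eventually_at_right_less)
    ultimately have lim: "(D 0 \<longlongrightarrow> 0) (at_right 0)"
      by (subst tendsto_cong) (auto elim!: eventually_mono simp: D0 theta_eq[OF assms])
    have zero: "theta1_deriv (Suc p) 0 x = 0" if x: "0 < x" for x
    proof -
      have "eventually (\<lambda>y. D 0 x \<le> D 0 y) (at_right 0)"
        using eventually_at_right_real[OF x]
        by eventually_elim (use cm_seq_decreasing[OF D, of _ x 0] in auto)
      then have "D 0 x \<le> 0"
        by (intro tendsto_lowerbound[OF lim]) auto
      moreover have "0 \<le> D 0 x"
        using cm_seqD(2)[OF D x, of 0] by simp
      ultimately show ?thesis
        using x by (simp add: D0 theta_eq[OF assms])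
    qed
    have "(theta1_deriv (Suc p) 0 \<longlongrightarrow> 0) (at_right 0)"
      by (rule tendsto_eventually) (use pos zero in \<open>auto elim!: eventually_mono\<close>)
    then show False
      using lim1 tendsto_unique[OF trivial_limit_at_right_real] by fastforce
  qed
qed

end
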